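(* Let $K/\mathbb Q$ be of degree $2$ with ring of integers $\mathcal O$, and let $\sigma$ be the nontrivial element of its Galois group. Then for any $z\in\mathbb K$, $\mu\in\mathbb P\mathbb K_{{\rm N}(\varepsilon)}$ and $\iota\in\mathbb P\mathbb K_\varepsilon$, $${\rm N}\big({}^*\mathcal O^{\mu[\iota]}_{\sigma(\mu)}(z)\big)\subset{}^*\mathbb Z^{{\rm N}(\mu)[{\rm N}(\iota)]}_{{\rm Tr}(\iota)}({\rm N}(z)).$$
   Context: Fix a nonprincipal ultrafilter on $\mathbb N$ and denote ultrapowers with ${}^*$. Let ${}^*\mathbb R_\varepsilon$ be the infinitesimals and ${}^*\mathbb R_{\rm fin}$ the bounded elements of ${}^*\mathbb R$, and $({}^*\mathbb R_{\rm fin})^\times_+$ the positive elements neither infinite nor infinitesimal. Let $\mathbb P:=({}^*\mathbb R_{>0}\cup\{0\})/({}^*\mathbb R_{\rm fin})^\times_+$, with induced product and total order, $-\infty:=$ class of $0$ (the minimum); for $x\in{}^*\mathbb C$ let $\langle x\rangle\in\mathbb P$ be the class of $|x|$. For $\theta\in\mathbb R$, ${}^*\mathbb Z(\theta)$ is the group of $n\in{}^*\mathbb Z$ for which there is a (unique) $n^\perp\in{}^*\mathbb Z$ with $\varepsilon(n):=n\theta-n^\perp\in{}^*\mathbb R_\varepsilon$. For classes $\mu,\nu,\iota\in\mathbb P$ of infinitesimals (possibly $-\infty$), ${}^*\mathbb Z^{\mu[\iota]}_\nu(\theta):=\{n\in{}^*\mathbb Z(\theta):\langle n\rangle\cdot\mu<\iota,\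 \langle\varepsilon(n)\rangle\le\nu\}$. Let $\tau_1,\tau_2:K\hookrightarrow\mathbb C$ be the two embeddings. The Minkowski space is $\mathbb K:=\{z=(z_1,z_2)\in\mathbb C^2:\overline{z_\tau}=z_{\overline\tau}\}$ (so $\mathbb K=\mathbb R^2$ if $K$ is real, and $z_2=\overline{z_1}$ if $K$ is imaginary), with $K$ embedded by $\alpha\mapsto(\tau_1(\alpha),\tau_2(\alpha))$, so ${}^*\mathcal O\subset{}^*\mathbb K$. ${}^*\mathbb K_\varepsilon$ is the set of elements of ${}^*\mathbb K$ with both coordinates infinitesimal (possibly zero). $\mathbb P\mathbb K$ is the set of pairs $\langle z\rangle:=(\langle z_1\rangle,\langle z_2\rangle)$, $z\in{}^*\mathbb K$, with coordinatewise product; $\mu\le\mu'$ (resp. $\mu<\mu'$) means the inequality (resp. strict inequality) in both coordinates. $\mathbb P\mathbb K_\varepsilon$ is the image of ${}^*\mathbb K_\varepsilon$. The norm is ${\rm N}(z)=z_1z_2\in{}^*\mathbb R$ for $z\in{}^*\mathbb K$ and ${\rm N}(\mu)=\mu_1\mu_2\in\mathbb P$ for $\mu\in\mathbb P\mathbb K$; ${\rm Tr}(\mu)=\max(\mu_1,\mu_2)\in\mathbb P$. $\mathbb P\mathbb K_{{\rm N}(\varepsilon)}:=\{\mu\in\mathbb P\mathbb K:{\rm N}(\mu)\text{ is the class of an infinitesimal (possibly }0)\}$. $\sigma$ acts on $\mathbb P\mathbb K$ by exchanging the two coordinates. For $z\in\mathbb K$, ${}^*\mathcal O(z)$ is the group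 of $\alpha\in{}^*\mathcal O$ for which there is a (unique) $\alpha^\perp\in{}^*\mathcal O$ with $\varepsilon(\alpha):=\alpha z-\alpha^\perp\in{}^*\mathbb K_\varepsilon$. For $\mu,\nu\in\mathbb P\mathbb K_{{\rm N}(\varepsilon)}$ and $\iota\in\mathbb P\mathbb K_\varepsilon$, $${}^*\mathcal O^{\mu[\iota]}_\nu(z):=\{\alpha\in{}^*\mathcal O(z):\langle\alpha\rangle\cdot\mu<\iota,\ \langle\varepsilon(\alpha)\rangle\le\nu\}.$$ *)

theory Defs
  imports Complex_Main "HOL-Computational_Algebra.Polynomial" "HOL-Library.Product_Plus"
begin

subsection \<open>Ultrapowers\<close>

definition nonprincipal_ultrafilter :: "'i filter \<Rightarrow> bool" where
  "nonprincipal_ultrafilter U \<longleftrightarrow>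
     U \<noteq> bot \<and>
     (\<forall>P. eventually P U \<or> eventually (\<lambda>i. \<not> P i) U) \<and>
     (\<forall>k. \<not> eventually (\<lambda>i. i = k) U)"

text \<open>
  An element of an ultrapower is a set of sequences, namely a class modulo equality
  \<open>U\<close>-almost everywhere. For \<open>A \<subseteq> B\<close> this makes \<open>ultrapower U A\<close> a subset of
  \<open>ultrapower U B\<close>.
\<close>

type_synonym 'a hyper = "(nat \<Rightarrow> 'a) set"

definition ucl :: "nat filter \<Rightarrow> (nat \<Rightarrow> 'a) \<Rightarrow> 'a hyper" where
  "ucl U X = {Y. eventually (\<lambda>n. Y n = X n) U}"

definition ultrapower :: "nat filter \<Rightarrow> 'a set \<Rightarrow> 'a hyper set" where
  "ultrapower U A = {ucl U X | X. \<forall>n. X n \<in> A}"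

definition ulift :: "nat filter \<Rightarrow> ('a \<Rightarrow> 'b) \<Rightarrow> 'a hyper \<Rightarrow> 'b hyper" where
  "ulift U f x = (\<Union>X\<in>x. ucl U (\<lambda>n. f (X n)))"

definition ulift2 ::
  "nat filter \<Rightarrow> ('a \<Rightarrow> 'b \<Rightarrow> 'c) \<Rightarrow> 'a hyper \<Rightarrow> 'b hyper \<Rightarrow> 'c hyper" where
  "ulift2 U f x y = (\<Union>X\<in>x. \<Union>Y\<in>y. ucl U (\<lambda>n. f (X n) (Y n)))"

definition urel ::
  "nat filter \<Rightarrow> ('a \<Rightarrow> 'b \<Rightarrow> bool) \<Rightarrow> 'a hyper \<Rightarrow> 'b hyper \<Rightarrow> bool" where
  "urel U R x y \<longleftrightarrow> (\<exists>X\<in>x. \<exists>Y\<in>y. eventually (\<lambda>n. R (X n) (Y n)) U)"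

definition uconst :: "nat filter \<Rightarrow> 'a \<Rightarrow> 'a hyper" where
  "uconst U a = ucl U (\<lambda>_. a)"

lemma ucl_self: "X \<in> ucl U X"
  by (simp add: ucl_def)

lemma ucl_eq_iff: "ucl U X = ucl U Y \<longleftrightarrow> eventually (\<lambda>n. X n = Y n) U"
proof
  assume "ucl U X = ucl U Y"
  then show "eventually (\<lambda>n. X n = Y n) U"
    using ucl_self[of X U] by (simp add: ucl_def)
next
  assume XY: "eventually (\<lambda>n. X n = Y n) U"
  show "ucl U X = ucl U Y"
    unfolding ucl_def
  proof (intro Collect_cong iffI)
    fix Z
    show "eventually (\<lambda>n. Z n = Y n) U" if "eventually (\<lambda>n. Z n = X n) U"
      using that XY by eventually_elim simp
    show "eventually (\<lambda>n. Z n = X n) U" if "eventually (\<lambda>n. Z n = Y n) U"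
      using that XY by eventually_elim simp
  qed
qed

lemma ulift_ucl: "ulift U f (ucl U X) = ucl U (\<lambda>n. f (X n))"
proof -
  have "ucl U (\<lambda>n. f (Y n)) = ucl U (\<lambda>n. f (X n))" if "Y \<in> ucl U X" for Y
    using that unfolding ucl_eq_iff by (auto simp: ucl_def elim: eventually_mono)
  then show ?thesis
    unfolding ulift_def using ucl_self[of X U] by blast
qed

lemma ulift2_ucl: "ulift2 U f (ucl U X) (ucl U Y) = ucl U (\<lambda>n. f (X n) (Y n))"
proof -
  have "ucl U (\<lambda>n. f (X' n) (Y' n)) = ucl U (\<lambda>n. f (X n) (Y n))"
    if "X' \<in> ucl U X" "Y' \<in> ucl U Y" for X' Y'
    using that unfolding ucl_eq_iff
    by (auto simp: ucl_def elim: eventually_elim2)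
  then show ?thesis
    unfolding ulift2_def using ucl_self[of X U] ucl_self[of Y U] by blast
qed


subsection \<open>Infinitesimals and growth classes\<close>

definition infinitesimals :: "nat filter \<Rightarrow> 'a::real_normed_vector set \<Rightarrow> 'a hyper set" where
  "infinitesimals U A =
     {x \<in> ultrapower U A. \<forall>r>0. urel U (<) (ulift U norm x) (uconst U r)}"

definition bounded_elements :: "nat filter \<Rightarrow> 'a::real_normed_vector set \<Rightarrow> 'a hyper set" where
  "bounded_elements U A =
     {x \<in> ultrapower U A. \<exists>r. urel U (\<le>) (ulift U norm x) (uconst U r)}"

definition pos_units :: "nat filter \<Rightarrow> real hyper set" where
  "pos_units U =
     {u \<in> bounded_elements U UNIV. urel U (<) (uconst U 0) u} - infinitesimals U UNIV"

text \<open>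
  The set of growth classes consists of the orbits of the positive finite units on the
  nonnegative hyperreals; \<open>growth U x\<close> is \<open>\<langle>x\<rangle>\<close>, the orbit of \<open>\<bar>x\<bar>\<close>.
\<close>

type_synonym pclass = "real hyper set"

definition pcl :: "nat filter \<Rightarrow> real hyper \<Rightarrow> pclass" where
  "pcl U a = (\<lambda>u. ulift2 U (*) u a) ` pos_units U"

definition growth :: "nat filter \<Rightarrow> 'a::real_normed_vector hyper \<Rightarrow> pclass" where
  "growth U x = pcl U (ulift U norm x)"

definition pmult :: "nat filter \<Rightarrow> pclass \<Rightarrow> pclass \<Rightarrow> pclass" where
  "pmult U p q = (\<Union>a\<in>p. \<Union>b\<in>q. pcl U (ulift2 U (*) a b))"

definition ple :: "nat filter \<Rightarrow> pclass \<Rightarrow> pclass \<Rightarrow> bool" where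
  "ple U p q \<longleftrightarrow> (\<exists>a\<in>p. \<exists>b\<in>q. urel U (\<le>) a b)"

definition pless :: "nat filter \<Rightarrow> pclass \<Rightarrow> pclass \<Rightarrow> bool" where
  "pless U p q \<longleftrightarrow> ple U p q \<and> p \<noteq> q"

definition pmax :: "nat filter \<Rightarrow> pclass \<Rightarrow> pclass \<Rightarrow> pclass" where
  "pmax U p q = (if ple U p q then q else p)"

definition P_infinitesimal :: "nat filter \<Rightarrow> pclass set" where
  "P_infinitesimal U = growth U ` infinitesimals U (UNIV :: real set)"


subsection \<open>Diophantine approximation groups of a real number\<close>

text \<open>
  The hyperintegers and the hyperreals are taken inside the ultrapower of the complex numbers,
  since the norm of an element of Minkowski space is a product of two complex coordinates.
  The parameter \<open>\<theta>\<close> is a complex number lying in \<open>\<real>\<close>.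
\<close>

definition hint :: "nat filter \<Rightarrow> complex hyper set" where
  "hint U = ultrapower U \<int>"

definition Z_err :: "nat filter \<Rightarrow> complex \<Rightarrow> complex hyper \<Rightarrow> complex hyper \<Rightarrow> complex hyper" where
  "Z_err U \<theta> n m = ulift2 U (-) (ulift2 U (*) n (uconst U \<theta>)) m"

definition Z_grp :: "nat filter \<Rightarrow> complex \<Rightarrow> complex hyper set" where
  "Z_grp U \<theta> = {n \<in> hint U. \<exists>m\<in>hint U. Z_err U \<theta> n m \<in> infinitesimals U \<real>}"

definition Z_perp :: "nat filter \<Rightarrow> complex \<Rightarrow> complex hyper \<Rightarrow> complex hyper" where
  "Z_perp U \<theta> n = (THE m. m \<in> hint U \<and> Z_err U \<theta> n m \<in> infinitesimals U \<real>)"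

definition Z_eps :: "nat filter \<Rightarrow> complex \<Rightarrow> complex hyper \<Rightarrow> complex hyper" where
  "Z_eps U \<theta> n = Z_err U \<theta> n (Z_perp U \<theta> n)"

definition Z_fine ::
  "nat filter \<Rightarrow> pclass \<Rightarrow> pclass \<Rightarrow> pclass \<Rightarrow> complex \<Rightarrow> complex hyper set" where
  "Z_fine U \<mu> \<iota> \<nu> \<theta> =
     {n \<in> Z_grp U \<theta>. pless U (pmult U (growth U n) \<mu>) \<iota> \<and> ple U (growth U (Z_eps U \<theta> n)) \<nu>}"


subsection \<open>Quadratic fields and Minkowski space\<close>

text \<open>\<open>K\<close> is the type \<open>'k\<close>; \<open>rat_degree TYPE('k)\<close> is \<open>[K : \<rat>]\<close>
  (and \<open>0\<close> if this is infinite).\<close>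

definition rat_degree :: "'k::field_char_0 itself \<Rightarrow> nat" where
  "rat_degree _ = vector_space.dim (\<lambda>(q::rat) (x::'k). of_rat q * x) UNIV"

definition field_embedding :: "('k::field \<Rightarrow> complex) \<Rightarrow> bool" where
  "field_embedding \<tau> \<longleftrightarrow>
     \<tau> 1 = 1 \<and> (\<forall>x y. \<tau> (x + y) = \<tau> x + \<tau> y) \<and> (\<forall>x y. \<tau> (x * y) = \<tau> x * \<tau> y)"

definition ring_of_integers :: "'k::field_char_0 set" where
  "ring_of_integers = {x. algebraic_int x}"

type_synonym cpair = "complex \<times> complex"

definition minkowski :: "('k \<Rightarrow> complex) \<Rightarrow> ('k \<Rightarrow> complex) \<Rightarrow> cpair set" where
  "minkowski \<tau>1 \<tau>2 = {(z1, z2).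
     \<forall>(\<tau>, w) \<in> {(\<tau>1, z1), (\<tau>2, z2)}. \<forall>(\<tau>', w') \<in> {(\<tau>1, z1), (\<tau>2, z2)}.
       cnj \<circ> \<tau> = \<tau>' \<longrightarrow> cnj w = w'}"

definition hinteger ::
  "nat filter \<Rightarrow> ('k::field_char_0 \<Rightarrow> complex) \<Rightarrow> ('k \<Rightarrow> complex) \<Rightarrow> cpair hyper set" where
  "hinteger U \<tau>1 \<tau>2 = ultrapower U ((\<lambda>x. (\<tau>1 x, \<tau>2 x)) ` ring_of_integers)"

definition kmult :: "cpair \<Rightarrow> cpair \<Rightarrow> cpair" where
  "kmult z w = (fst z * fst w, snd z * snd w)"

definition knorm :: "cpair \<Rightarrow> complex" where
  "knorm z = fst z * snd z"

definition hmink ::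
  "nat filter \<Rightarrow> ('k \<Rightarrow> complex) \<Rightarrow> ('k \<Rightarrow> complex) \<Rightarrow> cpair hyper set" where
  "hmink U \<tau>1 \<tau>2 = ultrapower U (minkowski \<tau>1 \<tau>2)"

definition hmink_eps ::
  "nat filter \<Rightarrow> ('k \<Rightarrow> complex) \<Rightarrow> ('k \<Rightarrow> complex) \<Rightarrow> cpair hyper set" where
  "hmink_eps U \<tau>1 \<tau>2 = {z \<in> hmink U \<tau>1 \<tau>2.
     ulift U fst z \<in> infinitesimals U UNIV \<and> ulift U snd z \<in> infinitesimals U UNIV}"

type_synonym pkclass = "pclass \<times> pclass"

definition kgrowth :: "nat filter \<Rightarrow> cpair hyper \<Rightarrow> pkclass" where
  "kgrowth U z = (growth U (ulift U fst z), growth U (ulift U snd z))"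

definition pkmult :: "nat filter \<Rightarrow> pkclass \<Rightarrow> pkclass \<Rightarrow> pkclass" where
  "pkmult U \<mu> \<nu> = (pmult U (fst \<mu>) (fst \<nu>), pmult U (snd \<mu>) (snd \<nu>))"

definition pkle :: "nat filter \<Rightarrow> pkclass \<Rightarrow> pkclass \<Rightarrow> bool" where
  "pkle U \<mu> \<nu> \<longleftrightarrow> ple U (fst \<mu>) (fst \<nu>) \<and> ple U (snd \<mu>) (snd \<nu>)"

text \<open>Strict in both coordinates, so this is not the strict part of \<open>pkle\<close>.\<close>

definition pkless :: "nat filter \<Rightarrow> pkclass \<Rightarrow> pkclass \<Rightarrow> bool" where
  "pkless U \<mu> \<nu> \<longleftrightarrow> pless U (fst \<mu>) (fst \<nu>) \<and> pless U (snd \<mu>) (snd \<nu>)"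

definition pknorm :: "nat filter \<Rightarrow> pkclass \<Rightarrow> pclass" where
  "pknorm U \<mu> = pmult U (fst \<mu>) (snd \<mu>)"

definition pktrace :: "nat filter \<Rightarrow> pkclass \<Rightarrow> pclass" where
  "pktrace U \<mu> = pmax U (fst \<mu>) (snd \<mu>)"

text \<open>The nontrivial element \<open>\<sigma>\<close> of the Galois group exchanges \<open>\<tau>1\<close> and \<open>\<tau>2\<close>, hence the
  two coordinates.\<close>

definition galois_conj :: "pkclass \<Rightarrow> pkclass" where
  "galois_conj \<mu> = (snd \<mu>, fst \<mu>)"

definition PK :: "nat filter \<Rightarrow> ('k \<Rightarrow> complex) \<Rightarrow> ('k \<Rightarrow> complex) \<Rightarrow> pkclass set" where
  "PK U \<tau>1 \<tau>2 = kgrowth U ` hmink U \<tau>1 \<tau>2"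

definition PK_eps :: "nat filter \<Rightarrow> ('k \<Rightarrow> complex) \<Rightarrow> ('k \<Rightarrow> complex) \<Rightarrow> pkclass set" where
  "PK_eps U \<tau>1 \<tau>2 = kgrowth U ` hmink_eps U \<tau>1 \<tau>2"

definition PK_Neps :: "nat filter \<Rightarrow> ('k \<Rightarrow> complex) \<Rightarrow> ('k \<Rightarrow> complex) \<Rightarrow> pkclass set" where
  "PK_Neps U \<tau>1 \<tau>2 = {\<mu> \<in> PK U \<tau>1 \<tau>2. pknorm U \<mu> \<in> P_infinitesimal U}"


subsection \<open>Diophantine approximation groups over the ring of integers\<close>

definition O_err :: "nat filter \<Rightarrow> cpair \<Rightarrow> cpair hyper \<Rightarrow> cpair hyper \<Rightarrow> cpair hyper" where
  "O_err U z \<alpha> \<beta> = ulift2 U (-) (ulift2 U kmult \<alpha> (uconst U z)) \<beta>"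

definition O_grp ::
  "nat filter \<Rightarrow> ('k::field_char_0 \<Rightarrow> complex) \<Rightarrow> ('k \<Rightarrow> complex) \<Rightarrow> cpair \<Rightarrow> cpair hyper set" where
  "O_grp U \<tau>1 \<tau>2 z = {\<alpha> \<in> hinteger U \<tau>1 \<tau>2.
     \<exists>\<beta>\<in>hinteger U \<tau>1 \<tau>2. O_err U z \<alpha> \<beta> \<in> hmink_eps U \<tau>1 \<tau>2}"

definition O_perp ::
  "nat filter \<Rightarrow> ('k::field_char_0 \<Rightarrow> complex) \<Rightarrow> ('k \<Rightarrow> complex) \<Rightarrow> cpair \<Rightarrow>
     cpair hyper \<Rightarrow> cpair hyper" where
  "O_perp U \<tau>1 \<tau>2 z \<alpha> =
     (THE \<beta>. \<beta> \<in> hinteger U \<tau>1 \<tau>2 \<and> O_err U z \<alpha> \<beta> \<in> hmink_eps U \<tau>1 \<tau>2)"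

definition O_eps ::
  "nat filter \<Rightarrow> ('k::field_char_0 \<Rightarrow> complex) \<Rightarrow> ('k \<Rightarrow> complex) \<Rightarrow> cpair \<Rightarrow>
     cpair hyper \<Rightarrow> cpair hyper" where
  "O_eps U \<tau>1 \<tau>2 z \<alpha> = O_err U z \<alpha> (O_perp U \<tau>1 \<tau>2 z \<alpha>)"

definition O_fine ::
  "nat filter \<Rightarrow> ('k::field_char_0 \<Rightarrow> complex) \<Rightarrow> ('k \<Rightarrow> complex) \<Rightarrow>
     pkclass \<Rightarrow> pkclass \<Rightarrow> pkclass \<Rightarrow> cpair \<Rightarrow> cpair hyper set" where
  "O_fine U \<tau>1 \<tau>2 \<mu> \<iota> \<nu> z =
     {\<alpha> \<in> O_grp U \<tau>1 \<tau>2 z.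
        pkless U (pkmult U (kgrowth U \<alpha>) \<mu>) \<iota> \<and> pkle U (kgrowth U (O_eps U \<tau>1 \<tau>2 z \<alpha>)) \<nu>}"

end

theory Submission
  imports Defs
begin

text \<open>
  With \<open>e = \<alpha> z - \<alpha>\<^sup>\<bottom>\<close> one has
  \<open>N(\<alpha>) N(z) - N(\<alpha>\<^sup>\<bottom>) = z\<^sub>1 \<alpha>\<^sub>1 e\<^sub>2 + z\<^sub>2 \<alpha>\<^sub>2 e\<^sub>1 - e\<^sub>1 e\<^sub>2\<close>. As \<open>\<langle>e\<^sub>2\<rangle> \<le> \<mu>\<^sub>1\<close> and
  \<open>\<langle>e\<^sub>1\<rangle> \<le> \<mu>\<^sub>2\<close>, the first two terms have classes below \<open>\<iota>\<^sub>1\<close> and \<open>\<iota>\<^sub>2\<close>. For \<open>\<alpha> \<noteq> 0\<close> the norm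
  \<open>N(\<alpha>)\<close> is a nonzero integer, so \<open>\<bar>e\<^sub>1 e\<^sub>2\<bar> \<le> \<bar>\<alpha>\<^sub>1 e\<^sub>2\<bar> \<bar>\<alpha>\<^sub>2 e\<^sub>1\<bar>\<close> and the third term is smaller still;
  for \<open>\<alpha> = 0\<close> also \<open>e = 0\<close>. Hence \<open>N(\<alpha>\<^sup>\<bottom>)\<close> is the dual integer of \<open>N(\<alpha>)\<close>, with error at most
  \<open>Tr(\<iota>)\<close>, and multiplying \<open>\<langle>\<alpha>\<rangle> \<mu> < \<iota>\<close> over both coordinates gives the growth condition.
\<close>

section \<open>Ultrapowers and growth classes\<close>

lemma urel_ucl: "urel U R (ucl U X) (ucl U Y) \<longleftrightarrow> eventually (\<lambda>n. R (X n) (Y n)) U"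
proof
  assume "urel U R (ucl U X) (ucl U Y)"
  then obtain X' Y' where "eventually (\<lambda>n. X' n = X n) U" "eventually (\<lambda>n. Y' n = Y n) U"
    "eventually (\<lambda>n. R (X' n) (Y' n)) U"
    by (auto simp: urel_def ucl_def)
  then show "eventually (\<lambda>n. R (X n) (Y n)) U"
    by eventually_elim simp
next
  assume "eventually (\<lambda>n. R (X n) (Y n)) U"
  then show "urel U R (ucl U X) (ucl U Y)"
    unfolding urel_def using ucl_self[of X U] ucl_self[of Y U] by blast
qed

lemma ucl_in_ultrapower_iff:
  assumes "A \<noteq> {}"
  shows "ucl U X \<in> ultrapower U A \<longleftrightarrow> eventually (\<lambda>n. X n \<in> A) U"
proof
  assume "ucl U X \<in> ultrapower U A"
  then obtain Y where "eventually (\<lambda>n. X n = Y n) U" "\<forall>n. Y n \<in> A"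
    by (auto simp: ultrapower_def ucl_eq_iff)
  then show "eventually (\<lambda>n. X n \<in> A) U"
    by (auto elim: eventually_mono)
next
  assume ev: "eventually (\<lambda>n. X n \<in> A) U"
  obtain a where "a \<in> A" using assms by auto
  \<comment> \<open>Values outside \<open>A\<close> occur only on a negligible set of indices; there
    they are replaced by the arbitrary \<open>a \<in> A\<close>.\<close>
  define Y where "Y n = (if X n \<in> A then X n else a)" for n
  have "ucl U X = ucl U Y"
    unfolding ucl_eq_iff using ev by eventually_elim (simp add: Y_def)
  moreover have "\<forall>n. Y n \<in> A" using \<open>a \<in> A\<close> by (simp add: Y_def)
  ultimately show "ucl U X \<in> ultrapower U A"
    by (auto simp: ultrapower_def)
qed

lemma ucl_in_infinitesimals_iff:
  assumes "A \<noteq> {}"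
  shows "ucl U X \<in> infinitesimals U A \<longleftrightarrow>
           eventually (\<lambda>n. X n \<in> A) U \<and> (\<forall>r>0. eventually (\<lambda>n. norm (X n) < r) U)"
  by (simp add: infinitesimals_def ucl_in_ultrapower_iff[OF assms] ulift_ucl uconst_def urel_ucl)

lemma ultrafilter_not_eventually:
  assumes "nonprincipal_ultrafilter U"
  shows "\<not> eventually P U \<longleftrightarrow> eventually (\<lambda>n. \<not> P n) U"
proof
  show "eventually (\<lambda>n. \<not> P n) U" if "\<not> eventually P U"
    using assms that by (auto simp: nonprincipal_ultrafilter_def)
  show "\<not> eventually P U" if "eventually (\<lambda>n. \<not> P n) U"
  proof
    assume "eventually P U"
    with that have "eventually (\<lambda>n. False) U" by eventually_elim simp
    then show False
      using assms by (simp add: nonprincipal_ultrafilter_def eventually_False)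
  qed
qed

section \<open>Growth classes of nonnegative sequences\<close>

lemma pos_units_iff:
  assumes U: "nonprincipal_ultrafilter U"
  shows "w \<in> pos_units U \<longleftrightarrow>
    (\<exists>X c C. w = ucl U X \<and> 0 < c \<and> eventually (\<lambda>n. c \<le> X n \<and> X n \<le> C) U)"
proof
  assume w: "w \<in> pos_units U"
  then obtain X where X: "w = ucl U X"
    by (auto simp: pos_units_def bounded_elements_def ultrapower_def)
  from w obtain C where C: "eventually (\<lambda>n. norm (X n) \<le> C) U"
    by (auto simp: pos_units_def bounded_elements_def X ulift_ucl uconst_def urel_ucl)
  from w have pos: "eventually (\<lambda>n. 0 < X n) U"
    by (auto simp: pos_units_def X uconst_def urel_ucl)
  \<comment> \<open>The ultrafilter turns "not eventually below \<open>c\<close>" into "eventually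
    at least \<open>c\<close>", so an element that is not infinitesimal has a positive standard
    lower bound.\<close>
  from w obtain c where "0 < c" and c: "eventually (\<lambda>n. \<not> norm (X n) < c) U"
    by (auto simp: pos_units_def X ucl_in_infinitesimals_iff ultrafilter_not_eventually[OF U])
  have "eventually (\<lambda>n. c \<le> X n \<and> X n \<le> C) U"
    using C pos c by eventually_elim simp
  with X \<open>0 < c\<close> show "\<exists>X c C. w = ucl U X \<and> 0 < c \<and> eventually (\<lambda>n. c \<le> X n \<and> X n \<le> C) U"
    by blast
next
  assume "\<exists>X c C. w = ucl U X \<and> 0 < c \<and> eventually (\<lambda>n. c \<le> X n \<and> X n \<le> C) U"
  then obtain X c C where X: "w = ucl U X" and "0 < c"
    and ev: "eventually (\<lambda>n. c \<le> X n \<and> X n \<le> C) U"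
    by blast
  have "eventually (\<lambda>n. norm (X n) \<le> C) U" "eventually (\<lambda>n. 0 < X n) U"
    using ev \<open>0 < c\<close> by (auto elim!: eventually_mono)
  moreover have "\<not> eventually (\<lambda>n. norm (X n) < c) U"
    unfolding ultrafilter_not_eventually[OF U] using ev by (auto elim!: eventually_mono)
  ultimately show "w \<in> pos_units U"
    using \<open>0 < c\<close>
    by (auto simp: pos_units_def bounded_elements_def X ulift_ucl uconst_def urel_ucl
        ucl_in_infinitesimals_iff ucl_in_ultrapower_iff)
qed

lemma pcl_ucl:
  assumes U: "nonprincipal_ultrafilter U"
  shows "pcl U (ucl U A) =
    {ucl U (\<lambda>n. X n * A n) | X. \<exists>c C. 0 < c \<and> eventually (\<lambda>n. c \<le> X n \<and> X n \<le> C) U}"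
proof (intro equalityI subsetI)
  fix w assume "w \<in> pcl U (ucl U A)"
  then obtain v where "v \<in> pos_units U" "w = ulift2 U (*) v (ucl U A)"
    by (auto simp: pcl_def)
  then show "w \<in> {ucl U (\<lambda>n. X n * A n) | X.
      \<exists>c C. 0 < c \<and> eventually (\<lambda>n. c \<le> X n \<and> X n \<le> C) U}"
    unfolding pos_units_iff[OF U] using ulift2_ucl[of U "(*)" _ A] by blast
next
  fix w assume "w \<in> {ucl U (\<lambda>n. X n * A n) | X.
      \<exists>c C. 0 < c \<and> eventually (\<lambda>n. c \<le> X n \<and> X n \<le> C) U}"
  then obtain X where w: "w = ucl U (\<lambda>n. X n * A n)" and X: "ucl U X \<in> pos_units U"
    unfolding pos_units_iff[OF U] by blast
  show "w \<in> pcl U (ucl U A)"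
    unfolding pcl_def using X by (rule rev_image_eqI) (simp add: w ulift2_ucl)
qed

lemma pcl_uclI:
  assumes "nonprincipal_ultrafilter U" and "w = ucl U (\<lambda>n. X n * A n)"
    and "0 < c" and "eventually (\<lambda>n. c \<le> X n \<and> X n \<le> C) U"
  shows "w \<in> pcl U (ucl U A)"
  unfolding pcl_ucl[OF assms(1)] using assms(2-) by auto

lemma ucl_in_pcl:
  assumes "nonprincipal_ultrafilter U"
  shows "ucl U A \<in> pcl U (ucl U A)"
  by (rule pcl_uclI[OF assms, of _ "\<lambda>_. 1" _ 1 1]) simp_all

text \<open>An orbit under the positive finite units forgets standard positive factors, so the order
  on classes is the big-O relation along \<open>U\<close>.\<close>

lemma ple_pcl_iff:
  assumes U: "nonprincipal_ultrafilter U"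
    and nonneg: "\<And>n. 0 \<le> A n" "\<And>n. 0 \<le> B n"
  shows "ple U (pcl U (ucl U A)) (pcl U (ucl U B)) \<longleftrightarrow>
           (\<exists>C>0. eventually (\<lambda>n. A n \<le> C * B n) U)"
proof
  assume "ple U (pcl U (ucl U A)) (pcl U (ucl U B))"
  then obtain X c C Y d D where "0 < c" and X: "eventually (\<lambda>n. c \<le> X n \<and> X n \<le> C) U"
    and Y: "0 < d" "eventually (\<lambda>n. d \<le> Y n \<and> Y n \<le> D) U"
    and XY: "eventually (\<lambda>n. X n * A n \<le> Y n * B n) U"
    by (auto simp: ple_def pcl_ucl[OF U] urel_ucl)
  \<comment> \<open>\<open>\<bar>D\<bar> + 1\<close> dominates \<open>D\<close> and is visibly
    positive, as the final constant has to be.\<close>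
  from X Y(2) XY have "eventually (\<lambda>n. A n \<le> (\<bar>D\<bar> + 1) / c * B n) U"
  proof eventually_elim
    case (elim n)
    have "c * A n \<le> X n * A n" using elim nonneg by (simp add: mult_right_mono)
    also have "\<dots> \<le> Y n * B n" using elim by simp
    also have "\<dots> \<le> (\<bar>D\<bar> + 1) * B n" using elim nonneg by (intro mult_right_mono) auto
    finally show ?case using \<open>0 < c\<close> by (simp add: field_simps)
  qed
  moreover have "(\<bar>D\<bar> + 1) / c > 0" using \<open>0 < c\<close> by simp
  ultimately show "\<exists>C>0. eventually (\<lambda>n. A n \<le> C * B n) U" by blast
next
  assume "\<exists>C>0. eventually (\<lambda>n. A n \<le> C * B n) U"
  then obtain C where "C > 0" and ev: "eventually (\<lambda>n. A n \<le> C * B n) U" by blast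
  have "ucl U (\<lambda>n. C * B n) \<in> pcl U (ucl U B)"
    using \<open>C > 0\<close> by (intro pcl_uclI[OF U, of _ "\<lambda>_. C" _ C C]) simp_all
  moreover have "urel U (\<le>) (ucl U A) (ucl U (\<lambda>n. C * B n))"
    using ev by (simp add: urel_ucl)
  ultimately show "ple U (pcl U (ucl U A)) (pcl U (ucl U B))"
    unfolding ple_def using ucl_in_pcl[OF U] by blast
qed


text \<open>The positive finite units form a group: bounds for \<open>Y * X\<close> and for
  \<open>Y / X\<close> come from those of \<open>X\<close> and \<open>Y\<close>, which gives the two
  inclusions.\<close>

lemma pcl_ucl_unit_mult:
  assumes U: "nonprincipal_ultrafilter U"
    and "0 < c" and X: "eventually (\<lambda>n. c \<le> X n \<and> X n \<le> C) U"
  shows "pcl U (ucl U (\<lambda>n. X n * A n)) = pcl U (ucl U A)"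
proof
  show "pcl U (ucl U (\<lambda>n. X n * A n)) \<subseteq> pcl U (ucl U A)"
  proof
    fix w assume "w \<in> pcl U (ucl U (\<lambda>n. X n * A n))"
    then obtain Y d D where w: "w = ucl U (\<lambda>n. Y n * (X n * A n))" and "0 < d"
      and Y: "eventually (\<lambda>n. d \<le> Y n \<and> Y n \<le> D) U"
      by (auto simp: pcl_ucl[OF U])
    have "eventually (\<lambda>n. d * c \<le> Y n * X n \<and> Y n * X n \<le> D * C) U"
      using X Y by eventually_elim (use \<open>0 < c\<close> \<open>0 < d\<close> in \<open>auto intro!: mult_mono\<close>)
    moreover have "0 < d * c" using \<open>0 < c\<close> \<open>0 < d\<close> by simp
    moreover have "w = ucl U (\<lambda>n. (Y n * X n) * A n)" unfolding w by (simp add: mult.assoc)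
    ultimately show "w \<in> pcl U (ucl U A)"
      by (intro pcl_uclI[OF U])
  qed
  show "pcl U (ucl U A) \<subseteq> pcl U (ucl U (\<lambda>n. X n * A n))"
  proof
    fix w assume "w \<in> pcl U (ucl U A)"
    then obtain Y d D where w: "w = ucl U (\<lambda>n. Y n * A n)" and "0 < d"
      and Y: "eventually (\<lambda>n. d \<le> Y n \<and> Y n \<le> D) U"
      by (auto simp: pcl_ucl[OF U])
    have "eventually (\<lambda>n. d / \<bar>C\<bar> \<le> Y n / X n \<and> Y n / X n \<le> D / c) U"
      using X Y by eventually_elim (use \<open>0 < c\<close> \<open>0 < d\<close> in \<open>auto intro!: frac_le\<close>)
    \<comment> \<open>A constant statement that holds eventually along a proper filter is true, so
      the upper bound \<open>C\<close> is positive.\<close>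
    moreover have "eventually (\<lambda>n. 0 < C) U" using X by eventually_elim (use \<open>0 < c\<close> in simp)
    then have "0 < C" using U by (auto simp: nonprincipal_ultrafilter_def eventually_const_iff)
    then have "0 < d / \<bar>C\<bar>" using \<open>0 < d\<close> by simp
    moreover have "w = ucl U (\<lambda>n. (Y n / X n) * (X n * A n))"
      unfolding w ucl_eq_iff using X by eventually_elim (use \<open>0 < c\<close> in simp)
    ultimately show "w \<in> pcl U (ucl U (\<lambda>n. X n * A n))"
      by (intro pcl_uclI[OF U])
  qed
qed

text \<open>Domination in both directions makes the quotient of \<open>A\<close> by \<open>B\<close>
  a positive finite unit, and this unit carries one orbit onto the other.\<close>

lemma ple_pcl_antisym:
  assumes U: "nonprincipal_ultrafilter U"
    and nonneg: "\<And>n. 0 \<le> A n" "\<And>n. 0 \<le> B n"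
    and "ple U (pcl U (ucl U A)) (pcl U (ucl U B))"
    and "ple U (pcl U (ucl U B)) (pcl U (ucl U A))"
  shows "pcl U (ucl U A) = pcl U (ucl U B)"
proof -
  obtain C D where "C > 0" "eventually (\<lambda>n. A n \<le> C * B n) U"
    "D > 0" "eventually (\<lambda>n. B n \<le> D * A n) U"
    using assms(4)[unfolded ple_pcl_iff[OF U nonneg]]
      assms(5)[unfolded ple_pcl_iff[OF U nonneg(2,1)]] by blast
  \<comment> \<open>Where \<open>B n = 0\<close>, domination forces \<open>A n = 0\<close> as well,
    so the default quotient 1 still satisfies \<open>A n = X n * B n\<close>.\<close>
  define X where "X n = (if B n = 0 then 1 else A n / B n)" for n
  have "eventually (\<lambda>n. A n = X n * B n) U"
    using \<open>eventually (\<lambda>n. A n \<le> C * B n) U\<close>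
  proof eventually_elim
    case (elim n)
    then show ?case using nonneg(1)[of n] by (cases "B n = 0") (simp_all add: X_def)
  qed
  then have "ucl U A = ucl U (\<lambda>n. X n * B n)" by (simp add: ucl_eq_iff)
  \<comment> \<open>The \<open>min\<close> and \<open>max\<close> with 1 make room for the default
    quotient.\<close>
  moreover have "eventually (\<lambda>n. min 1 (1 / D) \<le> X n \<and> X n \<le> max 1 C) U"
    using \<open>eventually (\<lambda>n. A n \<le> C * B n) U\<close> \<open>eventually (\<lambda>n. B n \<le> D * A n) U\<close>
  proof eventually_elim
    case (elim n)
    show ?case
    proof (cases "B n = 0")
      case False
      then have "B n > 0" using nonneg(2)[of n] by simp
      then have "1 / D \<le> X n" "X n \<le> C"
        using elim \<open>D > 0\<close> by (auto simp: X_def field_simps)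
      then show ?thesis by auto
    qed (simp add: X_def)
  qed
  ultimately show ?thesis
    using pcl_ucl_unit_mult[OF U, of "min 1 (1 / D)" X "max 1 C" B] \<open>D > 0\<close> by simp
qed

text \<open>By antisymmetry, strictness excludes the reverse comparison for every constant, and the
  ultrafilter converts each failure into an eventual strict inequality. The strict order is thus
  little-o along \<open>U\<close>.\<close>

lemma pless_pcl_iff:
  assumes U: "nonprincipal_ultrafilter U"
    and nonneg: "\<And>n. 0 \<le> A n" "\<And>n. 0 \<le> B n"
  shows "pless U (pcl U (ucl U A)) (pcl U (ucl U B)) \<longleftrightarrow>
           (\<forall>r>0. eventually (\<lambda>n. A n < r * B n) U)"
proof
  assume less: "pless U (pcl U (ucl U A)) (pcl U (ucl U B))"
  then have "\<not> ple U (pcl U (ucl U B)) (pcl U (ucl U A))"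
    using ple_pcl_antisym[of U A B, OF U nonneg] unfolding pless_def by blast
  then have ev: "eventually (\<lambda>n. \<not> B n \<le> C * A n) U" if "C > 0" for C
    using that by (auto simp: ple_pcl_iff[OF U nonneg(2,1)] ultrafilter_not_eventually[OF U])
  show "\<forall>r>0. eventually (\<lambda>n. A n < r * B n) U"
  proof (intro allI impI)
    fix r :: real assume "r > 0"
    then have "eventually (\<lambda>n. \<not> B n \<le> 1 / r * A n) U" by (intro ev) simp
    then show "eventually (\<lambda>n. A n < r * B n) U"
      by eventually_elim (use \<open>r > 0\<close> in \<open>simp add: field_simps\<close>)
  qed
next
  assume less: "\<forall>r>0. eventually (\<lambda>n. A n < r * B n) U"
  have "eventually (\<lambda>n. A n \<le> 1 * B n) U"
    using less[rule_format, of 1] by (auto elim: eventually_mono)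
  then have "ple U (pcl U (ucl U A)) (pcl U (ucl U B))"
    unfolding ple_pcl_iff[OF U nonneg] by (intro exI[of _ 1]) simp
  moreover have "pcl U (ucl U A) \<noteq> pcl U (ucl U B)"
  proof
    assume "pcl U (ucl U A) = pcl U (ucl U B)"
    then have "ple U (pcl U (ucl U B)) (pcl U (ucl U A))"
      using \<open>ple U (pcl U (ucl U A)) (pcl U (ucl U B))\<close> by simp
    then obtain C where "C > 0" and C: "eventually (\<lambda>n. B n \<le> C * A n) U"
      unfolding ple_pcl_iff[OF U nonneg(2,1)] by blast
    have "eventually (\<lambda>n. A n < 1 / C * B n) U"
      using less[rule_format, of "1 / C"] \<open>C > 0\<close> by simp
    then have "eventually (\<lambda>n. \<not> B n \<le> C * A n) U"
      by eventually_elim (use \<open>C > 0\<close> in \<open>simp add: field_simps\<close>)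
    with C show False using ultrafilter_not_eventually[OF U] by blast
  qed
  ultimately show "pless U (pcl U (ucl U A)) (pcl U (ucl U B))"
    by (simp add: pless_def)
qed

text \<open>The union in \<open>pmult\<close> ranges over all representatives; their unit factors
  are absorbed one after the other, so every set in the union is the same class.\<close>

lemma pmult_pcl:
  assumes U: "nonprincipal_ultrafilter U"
  shows "pmult U (pcl U (ucl U A)) (pcl U (ucl U B)) = pcl U (ucl U (\<lambda>n. A n * B n))"
proof -
  have eq: "pcl U (ulift2 U (*) a b) = pcl U (ucl U (\<lambda>n. A n * B n))"
    if a: "a \<in> pcl U (ucl U A)" and b: "b \<in> pcl U (ucl U B)" for a b
  proof -
    from a obtain X c C where X: "a = ucl U (\<lambda>n. X n * A n)" "0 < c"
        "eventually (\<lambda>n. c \<le> X n \<and> X n \<le> C) U"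
      by (auto simp: pcl_ucl[OF U])
    from b obtain Y d D where Y: "b = ucl U (\<lambda>n. Y n * B n)" "0 < d"
        "eventually (\<lambda>n. d \<le> Y n \<and> Y n \<le> D) U"
      by (auto simp: pcl_ucl[OF U])
    have "ulift2 U (*) a b = ucl U (\<lambda>n. X n * (Y n * (A n * B n)))"
      unfolding X(1) Y(1) ulift2_ucl by (simp add: mult_ac)
    then show ?thesis
      by (simp add: pcl_ucl_unit_mult[OF U X(2,3)] pcl_ucl_unit_mult[OF U Y(2,3)])
  qed
  then show ?thesis
    unfolding pmult_def using ucl_in_pcl[OF U, of A] ucl_in_pcl[OF U, of B] by blast
qed

text \<open>A sum grows like its dominant term: whichever of the two classes is the maximum absorbs
  the other summand into the constant.\<close>

lemma ple_pcl_pmax: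
  assumes U: "nonprincipal_ultrafilter U"
    and nonneg: "\<And>n. 0 \<le> A n" "\<And>n. 0 \<le> B n" "\<And>n. 0 \<le> E n"
    and "C > 0" and E: "eventually (\<lambda>n. E n \<le> C * (A n + B n)) U"
  shows "ple U (pcl U (ucl U E)) (pmax U (pcl U (ucl U A)) (pcl U (ucl U B)))"
proof (cases "ple U (pcl U (ucl U A)) (pcl U (ucl U B))")
  case True
  then obtain D where "D > 0" and D: "eventually (\<lambda>n. A n \<le> D * B n) U"
    by (auto simp: ple_pcl_iff[OF U nonneg(1,2)])
  have "eventually (\<lambda>n. E n \<le> C * (D + 1) * B n) U"
    using D E
  proof eventually_elim
    case (elim n)
    have "C * (A n + B n) \<le> C * ((D + 1) * B n)"
      using elim(1) \<open>C > 0\<close> by (intro mult_left_mono) (auto simp: algebra_simps)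
    with elim(2) show ?case by (simp add: mult.assoc)
  qed
  moreover have "C * (D + 1) > 0" using \<open>C > 0\<close> \<open>D > 0\<close> by simp
  ultimately have "ple U (pcl U (ucl U E)) (pcl U (ucl U B))"
    unfolding ple_pcl_iff[OF U nonneg(3,2)] by blast
  with True show ?thesis by (simp add: pmax_def)
next
  case False
  \<comment> \<open>The comparison fails for every constant; its failure for the constant 1 already
    gives \<open>B n < A n\<close> almost everywhere.\<close>
  then have "\<not> eventually (\<lambda>n. A n \<le> 1 * B n) U"
    unfolding ple_pcl_iff[OF U nonneg(1,2)] using zero_less_one by blast
  then have "eventually (\<lambda>n. \<not> A n \<le> 1 * B n) U"
    unfolding ultrafilter_not_eventually[OF U] .
  with E have "eventually (\<lambda>n. E n \<le> C * 2 * A n) U"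
  proof eventually_elim
    case (elim n)
    have "C * (A n + B n) \<le> C * (2 * A n)"
      using elim(2) \<open>C > 0\<close> by (intro mult_left_mono) auto
    with elim(1) show ?case by (simp add: mult.assoc)
  qed
  moreover have "C * 2 > 0" using \<open>C > 0\<close> by simp
  ultimately have "ple U (pcl U (ucl U E)) (pcl U (ucl U A))"
    unfolding ple_pcl_iff[OF U nonneg(3,1)] by blast
  with False show ?thesis by (simp add: pmax_def)
qed

section \<open>Quadratic fields\<close>

lemma field_embedding_simps:
  assumes "field_embedding \<tau>"
  shows field_embedding_one: "\<tau> 1 = 1"
    and field_embedding_add: "\<tau> (x + y) = \<tau> x + \<tau> y"
    and field_embedding_mult: "\<tau> (x * y) = \<tau> x * \<tau> y"
    and field_embedding_zero: "\<tau> 0 = 0"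
  using assms by (auto simp: field_embedding_def) (metis add_cancel_right_right)

lemma field_embedding_uminus:
  assumes "field_embedding \<tau>"
  shows "\<tau> (- x) = - \<tau> x"
  using field_embedding_add[OF assms, of x "- x"] field_embedding_zero[OF assms]
  by (simp add: eq_neg_iff_add_eq_0 add.commute)

lemma field_embedding_diff:
  assumes "field_embedding \<tau>"
  shows "\<tau> (x - y) = \<tau> x - \<tau> y"
  using field_embedding_add[OF assms, of x "- y"] field_embedding_uminus[OF assms] by simp

lemma field_embedding_eq_0_iff:
  assumes "field_embedding \<tau>"
  shows "\<tau> x = 0 \<longleftrightarrow> x = 0"
  using field_embedding_mult[OF assms, of x "inverse x"] field_embedding_one[OF assms]
    field_embedding_zero[OF assms]
  by (cases "x = 0") auto

lemma field_embedding_power: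
  assumes "field_embedding \<tau>"
  shows "\<tau> (x ^ n) = \<tau> x ^ n"
  by (induction n) (simp_all add: field_embedding_simps[OF assms])

lemma field_embedding_sum:
  assumes "field_embedding \<tau>"
  shows "\<tau> (sum f A) = (\<Sum>a\<in>A. \<tau> (f a))"
  by (induction A rule: infinite_finite_induct) (simp_all add: field_embedding_simps[OF assms])

lemma field_embedding_of_nat:
  assumes "field_embedding \<tau>"
  shows "\<tau> (of_nat k) = of_nat k"
  by (induction k) (simp_all add: field_embedding_simps[OF assms])

lemma field_embedding_of_int:
  assumes "field_embedding \<tau>"
  shows "\<tau> (of_int k) = of_int k"
  by (cases k)
    (simp_all add: field_embedding_of_nat[OF assms] field_embedding_uminus[OF assms]
      field_embedding_diff[OF assms] field_embedding_one[OF assms])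

lemma field_embedding_of_rat:
  fixes \<tau> :: "'k::field_char_0 \<Rightarrow> complex"
  assumes "field_embedding \<tau>"
  shows "\<tau> (of_rat q) = of_rat q"
proof -
  obtain a b where q: "q = Fract a b" and "b > 0" by (cases q)
  then have "of_rat q * of_int b = (of_int a :: 'k)" "of_rat q * of_int b = (of_int a :: complex)"
    by (simp_all add: of_rat_rat)
  then have "\<tau> (of_rat q) * of_int b = of_rat q * of_int b"
    by (metis field_embedding_mult[OF assms] field_embedding_of_int[OF assms])
  then show ?thesis using \<open>b > 0\<close> by simp
qed

text \<open>An irrational \<open>\<theta>\<close> is linearly independent of 1, and a
  \<open>y\<close> outside their span would give three independent vectors in a space spanned by
  two.\<close>

lemma quadratic_field_span:
  fixes \<theta> y :: "'k::field_char_0"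
  assumes deg: "rat_degree TYPE('k) = 2" and \<theta>: "\<theta> \<notin> \<rat>"
  obtains p q where "y = of_rat p + of_rat q * \<theta>"
proof -
  interpret vs: vector_space "\<lambda>(q::rat) (x::'k). of_rat q * x"
    by unfold_locales (simp_all add: algebra_simps of_rat_add of_rat_mult)
  obtain B where B: "UNIV \<subseteq> vs.span B" "card B = 2"
    using vs.basis_exists[of UNIV] deg unfolding rat_degree_def by metis
  then have "finite B" by (metis card.infinite zero_neq_numeral)
  have mem: "\<theta> \<notin> vs.span {1}"
    using \<theta> by (auto simp: vs.span_singleton Rats_def)
  have indep: "vs.independent {\<theta>, 1}"
    using mem by (intro vs.independent_insertI) (auto simp: vs.independent_empty)
  have "y \<in> vs.span {\<theta>, 1}"
  proof (rule ccontr)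
    assume y: "y \<notin> vs.span {\<theta>, 1}"
    then have "vs.independent {y, \<theta>, 1}" using indep by (rule vs.independent_insertI)
    then have "card {y, \<theta>, 1} \<le> 2"
      using vs.independent_span_bound[OF \<open>finite B\<close>, of "{y, \<theta>, 1}"] B by auto
    moreover have "y \<notin> {\<theta>, 1}" using y vs.span_base by blast
    moreover have "\<theta> \<noteq> 1" using \<theta> by auto
    ultimately show False by simp
  qed
  then obtain k l where "y - of_rat k * \<theta> = of_rat l * 1"
    by (auto simp: vs.span_insert[of \<theta>] vs.span_singleton)
  then have "y = of_rat l + of_rat k * \<theta>" by (simp add: algebra_simps)
  then show thesis by (rule that)
qed

section \<open>Finitely generated additive groups and denominators\<close>

interpretation int_module: module "\<lambda>(k::int) (x::'a::comm_ring_1). of_int k * x"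
  by unfold_locales (simp_all add: algebra_simps)

declare int_module.scale_scale [simp del] \<comment> \<open>loops with \<open>of_int_mult\<close>\<close>

text \<open>Bilinearity: induction over the first factor reduces to generators in \<open>A\<close>,
  and for these an induction over the second factor finishes.\<close>

lemma int_span_mult:
  fixes a b :: "'a::comm_ring_1"
  assumes "a \<in> int_module.span A" and "b \<in> int_module.span B"
  shows "a * b \<in> int_module.span ((\<lambda>(x, y). x * y) ` (A \<times> B))" (is "_ \<in> int_module.span ?C")
proof -
  have left: "x * b \<in> int_module.span ?C" if "x \<in> A" for x
    using assms(2)
  proof (induction rule: int_module.span_induct)
    case base
    show ?case
      by (auto simp: int_module.subspace_def distrib_left int_module.span_add
          int_module.span_zero mult.left_commute[of x] intro: int_module.span_scale)
  next
    case (step y)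
    with that show ?case by (intro int_module.span_base) auto
  qed
  from assms(1) show ?thesis
  proof (induction rule: int_module.span_induct)
    case base
    show ?case
      by (auto simp: int_module.subspace_def distrib_right mult.assoc int_module.span_add
          int_module.span_zero intro: int_module.span_scale)
  next
    case (step x)
    then show ?case by (rule left)
  qed
qed

text \<open>A monic integer relation of degree \<open>d\<close> rewrites \<open>x ^ d\<close> by
  lower powers, so the group generated by the first \<open>d\<close> powers is stable under
  multiplication by \<open>x\<close>.\<close>

lemma algebraic_int_powers_finite_span:
  fixes x :: "'a::field_char_0"
  assumes "algebraic_int x"
  obtains G where "finite G" "\<And>n. x ^ n \<in> int_module.span G"
proof -
  obtain p where p: "poly (map_poly of_int p) x = 0" "lead_coeff p = 1"
    using assms by (auto simp: algebraic_int_altdef_ipoly)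
  define d where "d = degree p"
  define G where "G = (\<lambda>i. x ^ i) ` {..<d}"
  have deg: "degree (map_poly of_int p :: 'a poly) = d"
    unfolding d_def by (intro degree_map_poly) auto
  have "(\<Sum>i\<le>d. of_int (coeff p i) * x ^ i) = 0"
    using p(1) by (simp add: poly_altdef deg coeff_map_poly)
  then have xd: "x ^ d = (\<Sum>i<d. of_int (- coeff p i) * x ^ i)"
    using p(2) by (simp add: lessThan_Suc_atMost[symmetric] d_def sum_negf add_eq_0_iff)
  have "x ^ d \<in> int_module.span G"
    unfolding xd G_def
    by (intro int_module.span_sum int_module.span_scale int_module.span_base) auto
  have "x ^ n \<in> int_module.span G" for n
  proof (induction n)
    case 0
    \<comment> \<open>For \<open>d = 0\<close> the relation \<open>xd\<close> would read
      \<open>1 = 0\<close>; hence \<open>x ^ 0\<close> is among the generators.\<close>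
    have "d > 0" using xd by (cases d) auto
    then show ?case
      unfolding G_def by (intro int_module.span_base image_eqI[of _ _ 0]) auto
  next
    case (Suc n)
    then have "x * x ^ n \<in> int_module.span G"
    proof (induction rule: int_module.span_induct)
      case base
      show ?case
        by (auto simp: int_module.subspace_def distrib_left int_module.span_add
            int_module.span_zero mult.left_commute[of x] intro: int_module.span_scale)
    next
      case (step y)
      then obtain i where "i < d" "y = x ^ i" by (auto simp: G_def)
      \<comment> \<open>Multiplication by \<open>x\<close> shifts each generator to the next one,
        except the last, which becomes \<open>x ^ d\<close>.\<close>
      then have "x * y = x ^ d \<or> x * y \<in> G"
        by (cases "Suc i = d") (auto simp: G_def intro!: image_eqI[of _ _ "Suc i"])
      then show ?case
        using \<open>x ^ d \<in> int_module.span G\<close> int_module.span_base by auto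
    qed
    then show ?case by simp
  qed
  then show thesis by (intro that[of G]) (simp_all add: G_def)
qed

text \<open>The binomial expansion contains only products of a power of \<open>x\<close> and a power
  of \<open>y\<close>, which lie in the span of the pairwise products of generators. This finiteness
  is all that the integrality of norms of differences requires.\<close>

lemma algebraic_int_add_powers_finite_span:
  fixes x y :: "'a::field_char_0"
  assumes "algebraic_int x" and "algebraic_int y"
  obtains G where "finite G" "\<And>n. (x + y) ^ n \<in> int_module.span G"
proof -
  obtain A where A: "finite A" "\<And>n. x ^ n \<in> int_module.span A"
    using algebraic_int_powers_finite_span[OF assms(1)] by blast
  obtain B where B: "finite B" "\<And>n. y ^ n \<in> int_module.span B"
    using algebraic_int_powers_finite_span[OF assms(2)] by blast
  define G where "G = (\<lambda>(x, y). x * y) ` (A \<times> B)"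
  have "(x + y) ^ n \<in> int_module.span G" for n
  proof -
    have "(x + y) ^ n = (\<Sum>k\<le>n. of_int (int (n choose k)) * (x ^ k * y ^ (n - k)))"
      by (simp add: binomial_ring mult.assoc)
    also have "\<dots> \<in> int_module.span G"
      unfolding G_def
      by (intro int_module.span_sum int_module.span_scale int_span_mult A(2) B(2))
    finally show ?thesis .
  qed
  with A(1) B(1) show thesis by (intro that[of G]) (simp_all add: G_def)
qed

text \<open>In lowest terms \<open>a / b\<close>, a fixed \<open>M\<close> that clears the
  denominator of every power is divisible by every \<open>b ^ n\<close>, which is impossible for
  \<open>b \<ge> 2\<close>.\<close>

lemma rational_int_if_bounded_denominators:
  fixes r :: "'a::field_char_0"
  assumes "r \<in> \<rat>" and "M \<noteq> 0" and int: "\<And>n. of_int M * r ^ n \<in> \<int>"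
  shows "r \<in> \<int>"
proof -
  obtain q where q: "r = of_rat q" using \<open>r \<in> \<rat>\<close> by (auto elim: Rats_cases)
  obtain a b where ab: "q = Fract a b" "b > 0" "coprime a b" by (cases q)
  have r: "r = of_int a / of_int b" using ab by (simp add: q of_rat_rat)
  have dvd: "b ^ n dvd M" for n
  proof -
    obtain k where "of_int M * r ^ n = (of_int k :: 'a)" using int[of n] by (auto elim: Ints_cases)
    then have "of_int (M * a ^ n) = (of_int (k * b ^ n) :: 'a)"
      using \<open>b > 0\<close> by (simp add: r power_divide field_simps)
    then have "M * a ^ n = k * b ^ n" unfolding of_int_eq_iff .
    then have "b ^ n dvd M * a ^ n" by simp
    moreover have "coprime (b ^ n) (a ^ n)" using ab(3) by (simp add: coprime_commute)
    ultimately show ?thesis by (simp add: coprime_dvd_mult_left_iff)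
  qed
  have "b = 1"
  proof (rule ccontr)
    assume "b \<noteq> 1"
    with ab(2) have "b \<ge> 2" by simp
    \<comment> \<open>With this exponent \<open>2 ^ n\<close> already exceeds
      \<open>\<bar>M\<bar>\<close>, contradicting the divisibility.\<close>
    define n where "n = nat \<bar>M\<bar>"
    have "int n < int (2 ^ n)" by (subst of_nat_less_iff) (rule less_exp)
    also have "\<dots> \<le> b ^ n" using \<open>b \<ge> 2\<close> by (simp add: power_mono)
    also have "\<dots> \<le> \<bar>M\<bar>" using dvd_imp_le_int[OF \<open>M \<noteq> 0\<close> dvd[of n]] ab(2) by simp
    finally show False by (simp add: n_def)
  qed
  then show ?thesis by (simp add: r)
qed

lemma Ints_norm_less_1:
  fixes k :: "'a::real_normed_algebra_1"
  assumes "k \<in> \<int>" and "norm k < 1"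
  shows "k = 0"
proof -
  obtain j where j: "k = of_int j" using assms(1) by (rule Ints_cases)
  have "\<bar>real_of_int j\<bar> < 1" using assms(2) unfolding j norm_of_int .
  then have "j = 0" by linarith
  then show ?thesis by (simp add: j)
qed

lemma Rats_common_denominator:
  fixes f :: "'b \<Rightarrow> 'a::field_char_0"
  assumes "finite A" and "\<forall>a\<in>A. f a \<in> \<rat>"
  shows "\<exists>M::int. M \<noteq> 0 \<and> (\<forall>a\<in>A. of_int M * f a \<in> \<int>)"
  using assms
proof (induction A rule: finite_induct)
  case empty
  show ?case by (intro exI[of _ 1]) simp
next
  case (insert x A)
  then obtain M :: int where M: "M \<noteq> 0" "\<forall>a\<in>A. of_int M * f a \<in> \<int>" by auto
  have "f x \<in> \<rat>" using insert.prems by simp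
  then obtain k l where "l > 0" and fx: "f x = of_int k / of_int l" by (rule Rats_cases')
  have "of_int (l * M) * f x = of_int (M * k)" using \<open>l > 0\<close> by (simp add: fx)
  also have "\<dots> \<in> \<int>" by (rule Ints_of_int)
  finally have "of_int (l * M) * f x \<in> \<int>" .
  moreover have "of_int (l * M) * f a \<in> \<int>" if "a \<in> A" for a
  proof -
    have "of_int (l * M) * f a = of_int l * (of_int M * f a)" by (simp add: mult.assoc)
    also have "\<dots> \<in> \<int>" by (rule Ints_mult[OF Ints_of_int bspec[OF M(2) that]])
    finally show ?thesis .
  qed
  moreover have "l * M \<noteq> 0" using M(1) \<open>l > 0\<close> by simp
  ultimately show ?case by (intro exI[of _ "l * M"]) auto
qed

section \<open>Norms in a quadratic field\<close>

locale quadratic_field =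
  fixes \<tau>1 \<tau>2 :: "'k::field_char_0 \<Rightarrow> complex"
  assumes degree_2: "rat_degree TYPE('k) = 2"
    and emb: "field_embedding \<tau>1" "field_embedding \<tau>2"
    and emb_neq: "\<tau>1 \<noteq> \<tau>2"
begin

text \<open>\<open>\<theta>\<close> is a primitive element with trace \<open>s\<close> and norm \<open>t\<close>.\<close>

lemma primitive_element:
  obtains \<theta> s t where "\<theta> \<notin> \<rat>" "\<theta> * \<theta> = of_rat s * \<theta> - of_rat t"
    "\<tau>1 \<theta> + \<tau>2 \<theta> = of_rat s" "\<tau>1 \<theta> * \<tau>2 \<theta> = of_rat t"
proof -
  obtain \<theta> where \<theta>: "\<tau>1 \<theta> \<noteq> \<tau>2 \<theta>" using emb_neq by blast
  have nr: "\<theta> \<notin> \<rat>"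
    using \<theta> emb by (auto simp: Rats_def field_embedding_of_rat)
  obtain p q where pq: "\<theta> * \<theta> = of_rat p + of_rat q * \<theta>"
    using quadratic_field_span[OF degree_2 nr, of "\<theta> * \<theta>"] by blast
  have root: "\<tau> \<theta> * \<tau> \<theta> = of_rat p + of_rat q * \<tau> \<theta>" if "field_embedding \<tau>" for \<tau>
    using arg_cong[OF pq, of \<tau>] that
    by (simp add: field_embedding_add field_embedding_mult field_embedding_of_rat)
  \<comment> \<open>Subtracting the quadratic equations of the two conjugates leaves their
    difference as a factor, which can be cancelled.\<close>
  have "(\<tau>1 \<theta> - \<tau>2 \<theta>) * (\<tau>1 \<theta> + \<tau>2 \<theta> - of_rat q) = 0"
    using root[OF emb(1)] root[OF emb(2)] by (simp add: algebra_simps)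
  then have tr: "\<tau>1 \<theta> + \<tau>2 \<theta> = of_rat q" using \<theta> by simp
  have "\<tau>1 \<theta> * (\<tau>1 \<theta> + \<tau>2 \<theta>) = \<tau>1 \<theta> * of_rat q" using tr by simp
  then have "\<tau>1 \<theta> * \<tau>2 \<theta> = of_rat (- p)"
    using root[OF emb(1)] by (simp add: algebra_simps of_rat_minus eq_neg_iff_add_eq_0)
  with nr pq tr show thesis
    by (intro that[of \<theta> q "- p"]) (simp_all add: of_rat_minus)
qed

text \<open>The image of \<open>\<theta>\<close> is a root of a quadratic polynomial with roots
  \<open>\<tau>1 \<theta>\<close> and \<open>\<tau>2 \<theta>\<close>, and it determines the
  embedding because 1 and \<open>\<theta>\<close> span the field over \<rat>.\<close>

lemma embedding_cases:
  assumes \<tau>: "field_embedding (\<tau> :: 'k \<Rightarrow> complex)"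
  shows "\<tau> = \<tau>1 \<or> \<tau> = \<tau>2"
proof -
  obtain \<theta> s t where nr: "\<theta> \<notin> \<rat>" and sq: "\<theta> * \<theta> = of_rat s * \<theta> - of_rat t"
    and st: "\<tau>1 \<theta> + \<tau>2 \<theta> = of_rat s" "\<tau>1 \<theta> * \<tau>2 \<theta> = of_rat t"
    using primitive_element .
  have "\<tau> \<theta> * \<tau> \<theta> = of_rat s * \<tau> \<theta> - of_rat t"
    using arg_cong[OF sq, of \<tau>] \<tau>
    by (simp add: field_embedding_diff field_embedding_mult field_embedding_of_rat)
  then have "(\<tau> \<theta> - \<tau>1 \<theta>) * (\<tau> \<theta> - \<tau>2 \<theta>) = 0"
    by (simp add: st[symmetric] algebra_simps)
  then have "\<tau> \<theta> = \<tau>1 \<theta> \<or> \<tau> \<theta> = \<tau>2 \<theta>" by simp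
  moreover have "\<tau> = \<tau>'" if "field_embedding \<tau>'" "\<tau> \<theta> = \<tau>' \<theta>" for \<tau>'
  proof
    fix y
    obtain p q where "y = of_rat p + of_rat q * \<theta>"
      using quadratic_field_span[OF degree_2 nr, of y] by blast
    then show "\<tau> y = \<tau>' y"
      using that \<tau> by (simp add: field_embedding_add field_embedding_mult field_embedding_of_rat)
  qed
  ultimately show ?thesis using emb by blast
qed

text \<open>In the basis 1, \<open>\<theta>\<close> the norm is a polynomial in the rational
  coordinates and in the trace and norm of \<open>\<theta>\<close>.\<close>

lemma norm_rational: "\<tau>1 x * \<tau>2 x \<in> \<rat>"
proof -
  obtain \<theta> s t where nr: "\<theta> \<notin> \<rat>"
    and st: "\<tau>1 \<theta> + \<tau>2 \<theta> = of_rat s" "\<tau>1 \<theta> * \<tau>2 \<theta> = of_rat t"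
    using primitive_element .
  obtain p q where x: "x = of_rat p + of_rat q * \<theta>"
    using quadratic_field_span[OF degree_2 nr, of x] by blast
  have "\<tau>1 x * \<tau>2 x =
      of_rat p * of_rat p + of_rat p * of_rat q * (\<tau>1 \<theta> + \<tau>2 \<theta>) + of_rat q * of_rat q * (\<tau>1 \<theta> * \<tau>2 \<theta>)"
    using emb by (simp add: x field_embedding_add field_embedding_mult field_embedding_of_rat
        algebra_simps)
  then show ?thesis unfolding st by simp
qed

text \<open>Polarisation of the norm form.\<close>

lemma polar_norm_rational: "\<tau>1 x * \<tau>2 y + \<tau>1 y * \<tau>2 x \<in> \<rat>"
proof -
  have "\<tau>1 x * \<tau>2 y + \<tau>1 y * \<tau>2 x =
      \<tau>1 (x + y) * \<tau>2 (x + y) - \<tau>1 x * \<tau>2 x - \<tau>1 y * \<tau>2 y"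
    using emb by (simp add: field_embedding_add algebra_simps)
  then show ?thesis
    using norm_rational by simp
qed

text \<open>The powers of the norm of \<open>x\<close> have bounded denominators.\<close>

lemma norm_in_Ints_if_powers_finite_span:
  assumes "finite G" and span: "\<And>n. x ^ n \<in> int_module.span G"
  shows "\<tau>1 x * \<tau>2 x \<in> \<int>"
proof -
  \<comment> \<open>A single product \<open>\<tau>1 g * \<tau>2 h\<close> need not be rational, but
    its symmetrisation is; so one integer \<open>M\<close> clears all denominators over the finitely
    many pairs.\<close>
  define w where "w = (\<lambda>(g, h). \<tau>1 g * \<tau>2 h + \<tau>1 h * \<tau>2 g)"
  have "w gh \<in> \<rat>" for gh
    unfolding w_def by (cases gh) (simp add: polar_norm_rational)
  then obtain M where M: "M \<noteq> 0" "\<And>gh. gh \<in> G \<times> G \<Longrightarrow> of_int M * w gh \<in> \<int>"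
    using Rats_common_denominator[of "G \<times> G" w] \<open>finite G\<close> by (metis finite_cartesian_product)
  \<comment> \<open>The factor 2 pays for symmetrising the double sum \<open>S\<close>
    below.\<close>
  have "2 * M \<noteq> 0" using M(1) by simp
  moreover have "of_int (2 * M) * (\<tau>1 x * \<tau>2 x) ^ n \<in> \<int>" for n
  proof -
    obtain c :: "'k \<Rightarrow> int" where c: "x ^ n = (\<Sum>g\<in>G. of_int (c g) * g)"
      using span[of n] unfolding int_module.span_finite[OF \<open>finite G\<close>] by auto
    have \<tau>: "\<tau> x ^ n = (\<Sum>g\<in>G. of_int (c g) * \<tau> g)" if "field_embedding \<tau>" for \<tau>
      using arg_cong[OF c, of \<tau>] that
      by (simp add: field_embedding_power field_embedding_sum field_embedding_mult
          field_embedding_of_int)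
    define S where "S = (\<Sum>g\<in>G. \<Sum>h\<in>G. of_int (c g * c h) * (\<tau>1 g * \<tau>2 h))"
    have S: "(\<tau>1 x * \<tau>2 x) ^ n = S"
      unfolding power_mult_distrib \<tau>[OF emb(1)] \<tau>[OF emb(2)] sum_product S_def
      by (intro sum.cong) simp_all
    \<comment> \<open>Exchanging the summation indices swaps the embeddings, so \<open>S + S\<close>
      involves only the symmetric \<open>w\<close>.\<close>
    have S': "S = (\<Sum>g\<in>G. \<Sum>h\<in>G. of_int (c g * c h) * (\<tau>1 h * \<tau>2 g))"
      unfolding S_def by (subst sum.swap) (simp add: mult.commute)
    have "S + S = (\<Sum>g\<in>G. \<Sum>h\<in>G. of_int (c g * c h) * (\<tau>1 g * \<tau>2 h)) +
        (\<Sum>g\<in>G. \<Sum>h\<in>G. of_int (c g * c h) * (\<tau>1 h * \<tau>2 g))"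
      by (rule arg_cong2[OF S_def S'])
    also have "\<dots> = (\<Sum>g\<in>G. \<Sum>h\<in>G. of_int (c g * c h) * w (g, h))"
      by (simp add: w_def sum.distrib distrib_left)
    finally have "of_int M * (S + S) = (\<Sum>g\<in>G. \<Sum>h\<in>G. of_int (c g * c h) * (of_int M * w (g, h)))"
      by (simp only: sum_distrib_left mult.left_commute[of "of_int M"])
    also have "\<dots> \<in> \<int>"
      by (intro Ints_sum, rule Ints_mult[OF Ints_of_int M(2)]) simp
    also have "of_int M * (S + S) = of_int (2 * M) * S" by simp
    finally show ?thesis unfolding S .
  qed
  ultimately show ?thesis
    by (rule rational_int_if_bounded_denominators[OF norm_rational])
qed

lemma norm_in_Ints:
  assumes "x \<in> ring_of_integers"
  shows "\<tau>1 x * \<tau>2 x \<in> \<int>"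
proof -
  obtain G where "finite G" "\<And>n. x ^ n \<in> int_module.span G"
    using algebraic_int_powers_finite_span assms unfolding ring_of_integers_def by blast
  then show ?thesis by (rule norm_in_Ints_if_powers_finite_span)
qed

text \<open>The powers of \<open>x + (- y)\<close> lie in a finitely generated group, so the
  criterion for integral norms applies. Uniqueness of the dual of \<open>\<alpha>\<close> rests on
  this.\<close>

lemma norm_diff_in_Ints:
  assumes "x \<in> ring_of_integers" and "y \<in> ring_of_integers"
  shows "\<tau>1 (x - y) * \<tau>2 (x - y) \<in> \<int>"
proof -
  have "algebraic_int x" "algebraic_int (- y)"
    using assms by (auto simp: ring_of_integers_def)
  then obtain G where "finite G" "\<And>n. (x + - y) ^ n \<in> int_module.span G"
    using algebraic_int_add_powers_finite_span by blast
  then have "\<tau>1 (x + - y) * \<tau>2 (x + - y) \<in> \<int>"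
    by (rule norm_in_Ints_if_powers_finite_span)
  then show ?thesis by simp
qed

text \<open>Discreteness of the integers in Minkowski space: an integral norm of absolute value
  below 1 vanishes. Integrality is asked of the norm alone, so that \<open>norm_diff_in_Ints\<close>
  can supply it for differences.\<close>

lemma eq_0_if_norm_less_1:
  assumes "\<tau>1 x * \<tau>2 x \<in> \<int>" and "norm (\<tau>1 x) < 1" and "norm (\<tau>2 x) < 1"
  shows "x = 0"
proof -
  have "norm (\<tau>1 x * \<tau>2 x) < 1 * 1"
    unfolding norm_mult using assms(2,3) by (intro mult_strict_mono') auto
  then have "\<tau>1 x * \<tau>2 x = 0"
    using assms(1) by (intro Ints_norm_less_1) auto
  then show ?thesis
    using emb by (simp add: field_embedding_eq_0_iff)
qed

text \<open>Complex conjugation permutes the two embeddings. If it fixes both, the coordinates of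
  \<open>z\<close> are real; if it exchanges them, the coordinates are conjugate. Either way their
  product is real.\<close>

lemma minkowski_norm_real:
  assumes z: "z \<in> minkowski \<tau>1 \<tau>2"
  shows "knorm z \<in> \<real>"
proof -
  obtain z1 z2 where zz: "z = (z1, z2)" by (cases z)
  have "field_embedding (cnj \<circ> \<tau>1)" "field_embedding (cnj \<circ> \<tau>2)"
    using emb by (auto simp: field_embedding_def)
  then have "cnj \<circ> \<tau>1 = \<tau>1 \<or> cnj \<circ> \<tau>1 = \<tau>2" "cnj \<circ> \<tau>2 = \<tau>1 \<or> cnj \<circ> \<tau>2 = \<tau>2"
    using embedding_cases by blast+
  \<comment> \<open>Being an involution, conjugation cannot send both embeddings to the same
    one.\<close>
  moreover have "cnj \<circ> (cnj \<circ> \<tau>) = \<tau>" for \<tau> :: "'k \<Rightarrow> complex" by auto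
  ultimately have "cnj \<circ> \<tau>1 = \<tau>1 \<and> cnj \<circ> \<tau>2 = \<tau>2 \<or> cnj \<circ> \<tau>1 = \<tau>2"
    using emb_neq by metis
  then have "cnj z1 = z1 \<and> cnj z2 = z2 \<or> cnj z1 = z2"
    using z by (auto simp: zz minkowski_def)
  then have "cnj (z1 * z2) = z1 * z2" by auto
  then show ?thesis by (simp add: zz knorm_def Reals_cnj_iff)
qed

text \<open>
  The term \<open>e1 * e2\<close> is absorbed by the other two because \<open>\<bar>N(x)\<bar> \<ge> 1\<close> unless \<open>x = 0\<close>, in which
  case \<open>y = 0\<close> as well.
\<close>

lemma norm_error_bound:
  assumes x: "x \<in> ring_of_integers" and y: "y \<in> ring_of_integers"
    and e1: "e1 = \<tau>1 x * z1 - \<tau>1 y" "norm e1 < 1"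
    and e2: "e2 = \<tau>2 x * z2 - \<tau>2 y" "norm e2 < 1"
    and p: "norm (\<tau>1 x) * norm e2 \<le> p" and q: "norm (\<tau>2 x) * norm e1 \<le> q"
  shows "norm (\<tau>1 x * \<tau>2 x * (z1 * z2) - \<tau>1 y * \<tau>2 y) \<le> norm z1 * p + norm z2 * q + p * q"
proof -
  have "p \<ge> 0" "q \<ge> 0"
    using p q by (meson mult_nonneg_nonneg norm_ge_zero order_trans)+
  have "norm (e1 * e2) \<le> (norm (\<tau>1 x) * norm e2) * (norm (\<tau>2 x) * norm e1)"
  proof (cases "x = 0")
    case True
    then have "\<tau>1 x = 0" "\<tau>2 x = 0" using emb by (simp_all add: field_embedding_zero)
    \<comment> \<open>For \<open>x = 0\<close> the errors are the negated conjugates of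
      \<open>y\<close>, so their smallness forces \<open>y\<close> to vanish.\<close>
    then have "y = 0"
      using e1 e2 by (intro eq_0_if_norm_less_1[OF norm_in_Ints[OF y]]) simp_all
    then have "e1 = 0"
      using e1(1) \<open>\<tau>1 x = 0\<close> emb by (simp add: field_embedding_zero)
    then show ?thesis by simp
  next
    case False
    then have "\<tau>1 x * \<tau>2 x \<noteq> 0" using emb by (simp add: field_embedding_eq_0_iff)
    then have "1 \<le> norm (\<tau>1 x * \<tau>2 x)"
      using Ints_norm_less_1[OF norm_in_Ints[OF x]] by fastforce
    then have "1 * norm (e1 * e2) \<le> norm (\<tau>1 x * \<tau>2 x) * norm (e1 * e2)"
      by (intro mult_right_mono) auto
    then show ?thesis by (simp add: norm_mult mult_ac)
  qed
  also have "\<dots> \<le> p * q"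
    using p q \<open>p \<ge> 0\<close> by (intro mult_mono) auto
  finally have pq: "norm (e1 * e2) \<le> p * q" .
  have "\<tau>1 x * \<tau>2 x * (z1 * z2) - \<tau>1 y * \<tau>2 y = z1 * (\<tau>1 x * e2) + z2 * (\<tau>2 x * e1) - e1 * e2"
    unfolding e1(1) e2(1) by (simp add: algebra_simps)
  also have "norm \<dots> \<le> norm (z1 * (\<tau>1 x * e2)) + norm (z2 * (\<tau>2 x * e1)) + norm (e1 * e2)"
    by (intro order_trans[OF norm_triangle_ineq4] add_right_mono norm_triangle_ineq)
  also have "\<dots> \<le> norm z1 * p + norm z2 * q + p * q"
    using p q pq by (intro add_mono) (auto simp: norm_mult intro!: mult_left_mono)
  finally show ?thesis .
qed

section \<open>Representatives and uniqueness of dual elements\<close>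

lemma hinteger_cases:
  assumes "\<alpha> \<in> hinteger U \<tau>1 \<tau>2"
  obtains x where "\<And>n. x n \<in> ring_of_integers" "\<alpha> = ucl U (\<lambda>n. (\<tau>1 (x n), \<tau>2 (x n)))"
proof -
  obtain X where X: "\<alpha> = ucl U X" "\<forall>n. X n \<in> (\<lambda>x. (\<tau>1 x, \<tau>2 x)) ` ring_of_integers"
    using assms by (auto simp: hinteger_def ultrapower_def)
  then have "\<forall>n. \<exists>x. x \<in> ring_of_integers \<and> X n = (\<tau>1 x, \<tau>2 x)" by auto
  then obtain x where "\<And>n. x n \<in> ring_of_integers \<and> X n = (\<tau>1 (x n), \<tau>2 (x n))" by metis
  then show thesis
    using X(1) by (intro that[of x]) (auto intro!: arg_cong[of _ _ "ucl U"])
qed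

lemma O_err_ucl:
  "O_err U z (ucl U (\<lambda>n. (\<tau>1 (x n), \<tau>2 (x n)))) (ucl U (\<lambda>n. (\<tau>1 (y n), \<tau>2 (y n)))) =
     ucl U (\<lambda>n. (\<tau>1 (x n) * fst z - \<tau>1 (y n), \<tau>2 (x n) * snd z - \<tau>2 (y n)))"
  by (simp add: O_err_def ulift2_ucl uconst_def kmult_def)

lemma hmink_eps_ucl_eventually:
  assumes "ucl U X \<in> hmink_eps U \<tau>1 \<tau>2" and "r > 0"
  shows "eventually (\<lambda>n. norm (fst (X n)) < r) U" "eventually (\<lambda>n. norm (snd (X n)) < r) U"
  using assms by (auto simp: hmink_eps_def ulift_ucl ucl_in_infinitesimals_iff)

text \<open>Both candidates are close to the product of \<open>\<alpha>\<close> and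
  \<open>z\<close>, so at almost every index their difference has integral norm and both conjugates
  below 1 in absolute value.\<close>

lemma O_perp_unique:
  assumes \<alpha>: "\<alpha> \<in> hinteger U \<tau>1 \<tau>2"
    and \<beta>: "\<beta> \<in> hinteger U \<tau>1 \<tau>2" "O_err U z \<alpha> \<beta> \<in> hmink_eps U \<tau>1 \<tau>2"
    and \<gamma>: "\<gamma> \<in> hinteger U \<tau>1 \<tau>2" "O_err U z \<alpha> \<gamma> \<in> hmink_eps U \<tau>1 \<tau>2"
  shows "\<beta> = \<gamma>"
proof -
  obtain x where x: "\<alpha> = ucl U (\<lambda>n. (\<tau>1 (x n), \<tau>2 (x n)))"
    using hinteger_cases[OF \<alpha>] by blast
  obtain y where y: "\<And>n. y n \<in> ring_of_integers" "\<beta> = ucl U (\<lambda>n. (\<tau>1 (y n), \<tau>2 (y n)))"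
    using hinteger_cases[OF \<beta>(1)] by blast
  obtain w where w: "\<And>n. w n \<in> ring_of_integers" "\<gamma> = ucl U (\<lambda>n. (\<tau>1 (w n), \<tau>2 (w n)))"
    using hinteger_cases[OF \<gamma>(1)] by blast
  have half: "(1/2 :: real) > 0" by simp
  have "eventually (\<lambda>n. y n = w n) U"
    using hmink_eps_ucl_eventually[OF \<beta>(2)[unfolded x y(2) O_err_ucl] half]
      hmink_eps_ucl_eventually[OF \<gamma>(2)[unfolded x w(2) O_err_ucl] half]
  proof eventually_elim
    case (elim n)
    have close: "norm (b - c) < 1" if "norm (a - b) < 1/2" "norm (a - c) < 1/2"
      for a b c :: complex
      using norm_triangle_ineq4[of "a - c" "a - b"] that by simp
    have "norm (\<tau>1 (y n - w n)) < 1" "norm (\<tau>2 (y n - w n)) < 1"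
      using elim close emb by (auto simp: field_embedding_diff)
    then have "y n - w n = 0"
      by (intro eq_0_if_norm_less_1 norm_diff_in_Ints y(1) w(1))
    then show ?case by simp
  qed
  then show ?thesis
    unfolding y(2) w(2) ucl_eq_iff by eventually_elim simp
qed

lemma O_perp:
  assumes "\<alpha> \<in> O_grp U \<tau>1 \<tau>2 z"
  shows "O_perp U \<tau>1 \<tau>2 z \<alpha> \<in> hinteger U \<tau>1 \<tau>2"
    and "O_err U z \<alpha> (O_perp U \<tau>1 \<tau>2 z \<alpha>) \<in> hmink_eps U \<tau>1 \<tau>2"
proof -
  have "\<exists>!\<beta>. \<beta> \<in> hinteger U \<tau>1 \<tau>2 \<and> O_err U z \<alpha> \<beta> \<in> hmink_eps U \<tau>1 \<tau>2"
    using assms O_perp_unique[of \<alpha> U _ z] unfolding O_grp_def by blast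
  from theI'[OF this] show "O_perp U \<tau>1 \<tau>2 z \<alpha> \<in> hinteger U \<tau>1 \<tau>2"
    and "O_err U z \<alpha> (O_perp U \<tau>1 \<tau>2 z \<alpha>) \<in> hmink_eps U \<tau>1 \<tau>2"
    unfolding O_perp_def by blast+
qed

end

text \<open>Two integers at distance less than \<open>1/2\<close> from a common point coincide. This
  identifies the norm of the dual of \<open>\<alpha>\<close> as the dual of the norm of
  \<open>\<alpha>\<close>.\<close>

lemma Z_perp_eqI:
  assumes n: "n \<in> hint U" and m: "m \<in> hint U" "Z_err U \<theta> n m \<in> infinitesimals U \<real>"
  shows "Z_perp U \<theta> n = m"
  unfolding Z_perp_def
proof (rule the_equality)
  fix m' assume m': "m' \<in> hint U \<and> Z_err U \<theta> n m' \<in> infinitesimals U \<real>"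
  obtain N M M' where seq: "n = ucl U N" "m = ucl U M" "m' = ucl U M'"
      "\<And>k. M k \<in> \<int>" "\<And>k. M' k \<in> \<int>"
    using n m(1) m' by (auto simp: hint_def ultrapower_def)
  have ne: "(\<real> :: complex set) \<noteq> {}" by auto
  have close: "eventually (\<lambda>k. norm (N k * \<theta> - M k) < r) U"
    "eventually (\<lambda>k. norm (N k * \<theta> - M' k) < r) U" if "r > 0" for r
    using m(2) m' that
    by (auto simp: seq Z_err_def ulift2_ucl uconst_def ucl_in_infinitesimals_iff[OF ne])
  have "eventually (\<lambda>k. norm (N k * \<theta> - M k) < 1/2) U" "eventually (\<lambda>k. norm (N k * \<theta> - M' k) < 1/2) U"
    by (rule close; simp)+
  then show "m' = m"
    unfolding seq ucl_eq_iff
  proof eventually_elim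
    case (elim k)
    have "norm (M' k - M k) < 1"
      using norm_triangle_ineq4[of "N k * \<theta> - M k" "N k * \<theta> - M' k"] elim by simp
    moreover have "M' k - M k \<in> \<int>" using seq(4,5) by simp
    ultimately have "M' k - M k = 0" by (intro Ints_norm_less_1)
    then show ?case by simp
  qed
qed (use m in simp)

section \<open>The inclusion of norms\<close>

theorem proposition25:
  fixes U :: "nat filter"
    and \<tau>1 \<tau>2 :: "'k::field_char_0 \<Rightarrow> complex"
    and z :: "complex \<times> complex"
    and \<mu> \<iota> :: pkclass
  assumes "nonprincipal_ultrafilter U"
    and "rat_degree TYPE('k) = 2"
    and "field_embedding \<tau>1" and "field_embedding \<tau>2" and "\<tau>1 \<noteq> \<tau>2"
    and "z \<in> minkowski \<tau>1 \<tau>2"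
    and "\<mu> \<in> PK_Neps U \<tau>1 \<tau>2"
    and "\<iota> \<in> PK_eps U \<tau>1 \<tau>2"
  shows "ulift U knorm ` O_fine U \<tau>1 \<tau>2 \<mu> \<iota> (galois_conj \<mu>) z
           \<subseteq> Z_fine U (pknorm U \<mu>) (pknorm U \<iota>) (pktrace U \<iota>) (knorm z)"
proof
  interpret quadratic_field \<tau>1 \<tau>2 using assms by unfold_locales
  note U = assms(1)
  have neZ: "(\<int> :: complex set) \<noteq> {}" and neR: "(\<real> :: complex set) \<noteq> {}" by auto
  \<comment> \<open>Sequences representing \<open>\<mu>\<close> and \<open>\<iota>\<close> turn
    every condition on classes into inequalities between real sequences.\<close>
  obtain M where M: "\<mu> = kgrowth U (ucl U M)"
    using assms(7) by (auto simp: PK_Neps_def PK_def hmink_def ultrapower_def)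
  obtain I where I: "\<iota> = kgrowth U (ucl U I)" "ucl U I \<in> hmink_eps U \<tau>1 \<tau>2"
    using assms(8) by (auto simp: PK_eps_def hmink_eps_def hmink_def ultrapower_def)
  define m1 m2 where m_def: "m1 = (\<lambda>n. norm (fst (M n)))" "m2 = (\<lambda>n. norm (snd (M n)))"
  define i1 i2 where i_def: "i1 = (\<lambda>n. norm (fst (I n)))" "i2 = (\<lambda>n. norm (snd (I n)))"
  have \<mu>: "\<mu> = (pcl U (ucl U m1), pcl U (ucl U m2))"
    by (simp add: M kgrowth_def growth_def ulift_ucl m_def)
  have \<iota>: "\<iota> = (pcl U (ucl U i1), pcl U (ucl U i2))"
    by (simp add: I(1) kgrowth_def growth_def ulift_ucl i_def)
  have nonneg: "m1 n \<ge> 0" "m2 n \<ge> 0" "i1 n \<ge> 0" "i2 n \<ge> 0" for n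
    by (simp_all add: m_def i_def)
  fix N assume "N \<in> ulift U knorm ` O_fine U \<tau>1 \<tau>2 \<mu> \<iota> (galois_conj \<mu>) z"
  then obtain \<alpha> where N: "N = ulift U knorm \<alpha>" and grp: "\<alpha> \<in> O_grp U \<tau>1 \<tau>2 z"
    and less: "pkless U (pkmult U (kgrowth U \<alpha>) \<mu>) \<iota>"
    and le: "pkle U (kgrowth U (O_eps U \<tau>1 \<tau>2 z \<alpha>)) (galois_conj \<mu>)"
    by (auto simp: O_fine_def)
  obtain x where x: "\<And>n. x n \<in> ring_of_integers" "\<alpha> = ucl U (\<lambda>n. (\<tau>1 (x n), \<tau>2 (x n)))"
    using grp hinteger_cases unfolding O_grp_def by blast
  obtain y where y: "\<And>n. y n \<in> ring_of_integers"
      "O_perp U \<tau>1 \<tau>2 z \<alpha> = ucl U (\<lambda>n. (\<tau>1 (y n), \<tau>2 (y n)))"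
    using O_perp(1)[OF grp] hinteger_cases by blast
  define e1 where "e1 n = \<tau>1 (x n) * fst z - \<tau>1 (y n)" for n
  define e2 where "e2 n = \<tau>2 (x n) * snd z - \<tau>2 (y n)" for n
  have eps: "O_eps U \<tau>1 \<tau>2 z \<alpha> = ucl U (\<lambda>n. (e1 n, e2 n))"
    unfolding O_eps_def y(2) unfolding x(2) O_err_ucl e1_def e2_def ..
  then have "ucl U (\<lambda>n. (e1 n, e2 n)) \<in> hmink_eps U \<tau>1 \<tau>2"
    using O_perp(2)[OF grp] by (simp add: O_eps_def)
  note small = hmink_eps_ucl_eventually[OF this zero_less_one, simplified]
  have h1: "eventually (\<lambda>n. norm (\<tau>1 (x n)) * m1 n < r * i1 n) U"
    and h2: "eventually (\<lambda>n. norm (\<tau>2 (x n)) * m2 n < r * i2 n) U" if "r > 0" for r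
    using less that nonneg
    by (simp_all add: pkless_def pkmult_def kgrowth_def growth_def x(2) ulift_ucl \<mu> \<iota>
        pmult_pcl[OF U] pless_pcl_iff[OF U])
  \<comment> \<open>The exchange of coordinates in \<open>galois_conj\<close> bounds
    \<open>e1\<close> by \<open>m2\<close> and \<open>e2\<close> by \<open>m1\<close>. Thus
    \<open>h1\<close> controls the product of \<alpha>'s first coordinate with \<open>e2\<close>,
    and \<open>h2\<close> the other mixed product.\<close>
  obtain C D where "C > 0" and C: "eventually (\<lambda>n. norm (e1 n) \<le> C * m2 n) U"
    and "D > 0" and D: "eventually (\<lambda>n. norm (e2 n) \<le> D * m1 n) U"
    using le nonneg
    by (auto simp: pkle_def kgrowth_def growth_def eps ulift_ucl \<mu> galois_conj_def
        ple_pcl_iff[OF U])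
  \<comment> \<open>\<open>B\<close> represents the norm of the dual of \<open>\<alpha>\<close>, the
    candidate dual of \<open>N\<close>, and \<open>E\<close> the resulting error.\<close>
  define B where "B = (\<lambda>n. \<tau>1 (y n) * \<tau>2 (y n))"
  define E where "E = (\<lambda>n. \<tau>1 (x n) * \<tau>2 (x n) * knorm z - B n)"
  \<comment> \<open>The three summands are the constants of the three terms in
    \<open>norm_error_bound\<close> with \<open>p = D * i1 n\<close> and
    \<open>q = C * i2 n\<close>.\<close>
  define Q where "Q = norm (fst z) * D + norm (snd z) * C + D * C"
  have "Q > 0" unfolding Q_def using \<open>C > 0\<close> \<open>D > 0\<close> by (simp add: add_nonneg_pos)
  have bound: "eventually (\<lambda>n. norm (E n) \<le> Q * (i1 n + i2 n)) U"
    using small h1[OF zero_less_one] h2[OF zero_less_one] C D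
      hmink_eps_ucl_eventually(2)[OF I(2) zero_less_one]
  proof eventually_elim
    case (elim n)
    have "norm (\<tau>1 (x n)) * norm (e2 n) \<le> norm (\<tau>1 (x n)) * (D * m1 n)"
      using elim by (intro mult_left_mono) auto
    also have "\<dots> = D * (norm (\<tau>1 (x n)) * m1 n)" by simp
    also have "\<dots> \<le> D * i1 n" using elim \<open>D > 0\<close> by (intro mult_left_mono) auto
    finally have p: "norm (\<tau>1 (x n)) * norm (e2 n) \<le> D * i1 n" .
    have "norm (\<tau>2 (x n)) * norm (e1 n) \<le> norm (\<tau>2 (x n)) * (C * m2 n)"
      using elim by (intro mult_left_mono) auto
    also have "\<dots> = C * (norm (\<tau>2 (x n)) * m2 n)" by simp
    also have "\<dots> \<le> C * i2 n" using elim \<open>C > 0\<close> by (intro mult_left_mono) auto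
    finally have q: "norm (\<tau>2 (x n)) * norm (e1 n) \<le> C * i2 n" .
    have "norm (E n) \<le> norm (fst z) * (D * i1 n) + norm (snd z) * (C * i2 n) + (D * i1 n) * (C * i2 n)"
      unfolding E_def B_def knorm_def using elim p q
      by (intro norm_error_bound[OF x(1) y(1) e1_def _ e2_def]) auto
    \<comment> \<open>Since \<open>\<iota>\<close> is infinitesimal, \<open>i2 n \<le> 1\<close>,
      which makes the quadratic term linear in \<open>i1 n\<close>.\<close>
    also have "(D * i1 n) * (C * i2 n) \<le> (D * i1 n) * (C * 1)"
      using elim nonneg \<open>C > 0\<close> \<open>D > 0\<close> by (intro mult_left_mono) (auto simp: i_def)
    also have "norm (fst z) * (D * i1 n) + norm (snd z) * (C * i2 n) + (D * i1 n) * (C * 1)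
        \<le> Q * (i1 n + i2 n)"
      using nonneg \<open>C > 0\<close> \<open>D > 0\<close> by (simp add: Q_def algebra_simps)
    finally show ?case by simp
  qed
  have N_ucl: "N = ucl U (\<lambda>n. \<tau>1 (x n) * \<tau>2 (x n))"
    by (simp add: N x(2) ulift_ucl knorm_def)
  have hint: "N \<in> hint U" "ucl U B \<in> hint U"
    unfolding N_ucl hint_def ucl_in_ultrapower_iff[OF neZ] B_def
    using norm_in_Ints x(1) y(1) by simp_all
  have err: "Z_err U (knorm z) N (ucl U B) = ucl U E"
    by (simp add: Z_err_def N_ucl uconst_def ulift2_ucl E_def)
  have "eventually (\<lambda>n. norm (E n) < r) U" if "r > 0" for r
  proof -
    \<comment> \<open>With both coordinates of \<open>I n\<close> below this threshold their sum is
      below \<open>r / Q\<close>.\<close>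
    have "r / (2 * Q) > 0" using that \<open>Q > 0\<close> by simp
    from bound hmink_eps_ucl_eventually[OF I(2) this] show ?thesis
    proof eventually_elim
      case (elim n)
      then have "i1 n + i2 n < r / Q" by (simp add: i_def)
      with elim(1) \<open>Q > 0\<close> show ?case by (simp add: field_simps)
    qed
  qed
  moreover have "E n \<in> \<real>" for n
  proof -
    have "\<tau>1 (x n) * \<tau>2 (x n) \<in> \<real>" "B n \<in> \<real>"
      using norm_in_Ints[OF x(1)[of n]] norm_in_Ints[OF y(1)[of n]] unfolding B_def
      by (auto elim!: Ints_cases)
    then show ?thesis
      unfolding E_def using minkowski_norm_real[OF assms(6)] by simp
  qed
  ultimately have inf: "Z_err U (knorm z) N (ucl U B) \<in> infinitesimals U \<real>"
    unfolding err ucl_in_infinitesimals_iff[OF neR] by simp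
  have Z_eps: "Z_eps U (knorm z) N = ucl U E"
    unfolding Z_eps_def Z_perp_eqI[OF hint inf] err ..
  have "N \<in> Z_grp U (knorm z)"
    unfolding Z_grp_def using hint inf by blast
  moreover have "pless U (pmult U (growth U N) (pknorm U \<mu>)) (pknorm U \<iota>)"
  proof -
    have "eventually (\<lambda>n. norm (\<tau>1 (x n) * \<tau>2 (x n)) * (m1 n * m2 n) < r * (i1 n * i2 n)) U"
      if "r > 0" for r
      \<comment> \<open>The arbitrary factor \<open>r\<close> is spent on one coordinate; the other
        needs only the factor 1.\<close>
      using h1[OF that] h2[OF zero_less_one]
    proof eventually_elim
      case (elim n)
      have "(norm (\<tau>1 (x n)) * m1 n) * (norm (\<tau>2 (x n)) * m2 n) < (r * i1 n) * (1 * i2 n)"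
        by (rule mult_strict_mono'[OF elim]) (simp_all add: nonneg)
      then show ?case by (simp add: norm_mult mult_ac)
    qed
    then show ?thesis
      using nonneg
      by (simp add: N_ucl growth_def ulift_ucl pknorm_def \<mu> \<iota> pmult_pcl[OF U] pless_pcl_iff[OF U])
  qed
  moreover have "ple U (growth U (Z_eps U (knorm z) N)) (pktrace U \<iota>)"
    unfolding Z_eps growth_def ulift_ucl pktrace_def \<iota> fst_conv snd_conv
    by (rule ple_pcl_pmax[OF U nonneg(3,4) norm_ge_zero \<open>Q > 0\<close> bound])
  ultimately show "N \<in> Z_fine U (pknorm U \<mu>) (pknorm U \<iota>) (pktrace U \<iota>) (knorm z)"
    by (simp add: Z_fine_def)
qed

end
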